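(* Let $n\ge k>0$ be integers, let $\lambda,\mu$ be binary sequences of length $n$ with exactly $k$ ones, and let $P^{\emptyset,\Omega}_{\lambda\mu}$ be a $\nu$-free puzzle with $\Omega=\Omega_t\cup\Omega_r\cup\Omega_b$. Let $\overline\Omega$ be a separable atomic refinement of $\Omega$, let $I^{\emptyset,\Omega}_{\lambda\mu}\subseteq\mathbb{F}_3[\boldsymbol x]$ be the $\nu$-free puzzle ideal of $P^{\emptyset,\Omega}_{\lambda\mu}$, and let $I^{\emptyset,\Omega}=I^{\emptyset,\Omega}_{\lambda\mu}\cap\mathbb{F}_3[\boldsymbol x_b]$ be its elimination ideal with respect to the variables $\boldsymbol x_b=\{x_{b1},\dots,x_{bn}\}$ of the bottom side. Then: (1) $I^{\emptyset,\Omega}$ is radical. (2) Let $I^{\emptyset,\Omega}=\bigcap_k p_k$ be the prime decomposition of $I^{\emptyset,\Omega}$. Then each $p_k$ is of the form $\langle x_{b1}-\overline\nu_{k1},\dots,x_{bn}-\overline\nu_{kn}\rangle$, where $\overline\nu_{ki}\in\mathbb{F}_2=\{0,1\}$ for $i=1,\dots,n$. (3) Let $\overline\nu_k=(\overline\nu_{k1},\dots,\overline\nu_{kn})\in V(I^{\emptyset,\Omega})$ and let $p_k$ be the prime ideal corresponding to it. Then $I^{\overline\nu_k,\Omega}_{\lambda\mu}=I^{\emptyset,\Omega}_{\lambda\mu}+p_k$, where $I^{\emptyset,\Omega}_{\lambda\mu}+p_k$ is the ideal of $\mathbb{F}_3[\boldsymbol x]$ generated by $I^{\emptyset,\Omega}_{\lambda\mu}$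 and $p_k$, and $I^{\overline\nu_k,\Omega}_{\lambda\mu}$ is the puzzle ideal of $P^{\overline\nu_k,\Omega}_{\lambda\mu}$.
   Context: **Puzzles.** Consider the upward equilateral triangle of side length $n$, subdivided into $n^2$ unit triangles with $N=\frac{3n(n+1)}{2}$ unit intervals as sides. $\bigtriangleup^{\nu}_{\lambda\mu}$ ($\nu\in\mathbb{F}_2^n$) is this triangle with the unit intervals of its left, right and bottom sides carrying the values of $\lambda,\mu,\nu$, each side read from left to right; $\bigtriangleup^\emptyset_{\lambda\mu}$ is the same with no prescribed values on the bottom side. An $\mathbb{F}_q$-valued puzzle piece is a convex polygon whose sides are parallel to sides of the big triangle and of integer length, with an $\mathbb{F}_q$-value on each unit interval of its boundary. A tiling with a set of pieces is a covering by translates of pieces of the set (repetition allowed; no rotation or mirroring) without overlaps or gaps, such that values on common edges of adjacent pieces match and prescribed boundary values match. $\mathbb{F}_2$-values are embedded in $\mathbb{F}_3$ as $0,1$. $\Omega(t)$ denotes the set of pieces appearing in a tiling $t$. The puzzle $P^{\nu,\Omega}_{\lambda\mu}$ (resp. $\nu$-free puzzle $P^{\emptyset,\Omega}_{\lambda\mu}$) consists of $\bigtriangleup^\nu_{\lambda\mu}$ (resp. $\bigtriangleup^\emptyset_{\lambda\mu}$) and a set $\Omega$ of $\mathbb{F}_2$-valued pieces. **Shapes.** $\Omega=\Omega_t\cup\Omega_r\cup\Omega_b$ means: the pieces in $\Omega$ are unit triangles ($\Omega_t$), unit rhombuses ($\Omega_r$), or all of the shape of one fixed bigger convex polygon ($\Omega_b$,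 possibly empty). **Atomic refinement.** An atomic piece is an $\mathbb{F}_3$-valued unit triangle whose three values sum to $0$ in $\mathbb{F}_3$. It is regular if it is not $(0,0,0)$-, $(1,1,1)$- or $(2,2,2)$-valued. $\Omega$ is refinable if each $p\in\Omega$ has a tiling $\overline t_p$ with atomic pieces; this is assumed throughout. Given a choice of such tilings, $\overline\Omega=\bigcup_{p\in\Omega}\Omega(\overline t_p)$ is the atomic refinement of $\Omega$ induced by $\{\overline t_p\}$. **Stitching.** The stitching of a tiling with $\overline\Omega$ is obtained by replacing every pair of regular atomic pieces sharing a $2$-valued side by the $\mathbb{F}_2$-valued unit rhombus they form. $\tilde t_p$ denotes the stitching of $\overline t_p$. **Implicit, separable, forbidden.** For $p\in\Omega_b$, the pieces in $\Omega_i(\overline t_p)=\Omega(\tilde t_p)\setminus\Omega$ are implicit w.r.t. $\overline t_p$; $\overline\Omega_i$ is the union of these sets. (The implicit pieces used below are the $(2,2,2)$-valued atomic pieces and the $\mathbb{F}_2$-valued rhombuses.) $\overline\Omega$ is separable if (1) every piece implicit w.r.t. $\overline t_p$ occurs only once in $\tilde t_p$, and (2) $\Omega_i(\overline t_p)\cap\Omega_i(\overline t_q)=\emptyset$ for distinct $p,q\in\Omega_b$. Let $\overline\Omega_r$ be the set of $\mathbb{F}_2$-valued unit rhombus pieces that have a tiling with $\overline\Omega$ but not with $\Omega$; the forbidden pieces are those in $\overline\Omega_f=\overline\Omega_r\setminus\overline\Omega_i$. **Distinguishing polynomials.** An upward (downward) atomic piece is identified with the vector of values of its left, right, bottom (left,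 top, right) sides. An upward (downward) distinguishing polynomial w.r.t. $\overline\Omega$ is $f\in\mathbb{F}_3[x,y,z]/\langle x^3-x,y^3-y,z^3-z\rangle$ such that for each upward (downward) atomic piece $a$: $f(a)=0$ iff $a\in\overline\Omega$. **Forbidding polynomials.** Let $\Psi$ be the set of $\mathbb{F}_3$-valued unit rhombus pieces having a tiling with $\overline\Omega$, and $\Psi_l,\Psi_r,\Psi_b$ its subsets with middle interval parallel to the left, right, bottom side of the big triangle. A piece in $\Psi_l$ or $\Psi_r$ is identified with the vector of its top, right, bottom, left values; a piece in $\Psi_b$ with its NW, NE, SE, SW values. A left (right, bottom) forbidding polynomial is $f\in\mathbb{F}_3[z_1,\dots,z_4]/\langle z_i^3-z_i\rangle$ such that for each $a\in\Psi_l$ ($\Psi_r,\Psi_b$): $f(a)\ne0$ iff $a\in\overline\Omega_f$. **Implying polynomials.** Let the polygon shape of $\Omega_b$ have $m$ unit intervals $I_1,\dots,I_m$ (boundary and interior). For an implicit piece $\overline p$ corresponding to the unique $p\in\Omega_b$ with $\overline p\in\Omega_i(\overline t_p)$, let $\overline{\boldsymbol x}\in\mathbb{F}_3^m$ be the values assigned by $\overline t_p$ to $I_1,\dots,I_m$, and let $K\subseteq\{1,\dots,m\}$ index the boundary intervals of the unique occurrence of $\overline p$ in $\tilde t_p$ ($|K|=4$ for a rhombus, $3$ for the $(2,2,2)$-valued piece). An implying polynomial of $\overline p$ is $f_{\overline p}\in\mathbb{F}_3[z_1,\dots,z_m]/\langle z_i^3-z_i\rangle$ with $f_{\overline p}(\overline{\boldsymbol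 x})=0$ and $f_{\overline p}(\boldsymbol z)=1$ for every $\boldsymbol z\neq\overline{\boldsymbol x}$ in $\mathbb{F}_3^m$ agreeing with $\overline{\boldsymbol x}$ on $K$. **Ideals.** Introduce variables $\boldsymbol x=\{x_1,\dots,x_N\}$, one per unit interval; $x_{lj},x_{rj},x_{bj}$ are the variables of the $j$-th intervals (left to right) of the left, right, bottom sides. Fix choices of distinguishing, forbidding and implying polynomials (the same for all ideals below). Set: $\mathcal F_1=\{x_i^3-x_i: 1\le i\le N\}$; $\mathcal F_2=\{x_{lj}-\lambda_j,\ x_{rj}-\mu_j,\ x_{bj}-\nu_j: 1\le j\le n\}$; $\tilde{\mathcal F}_1$ = $\mathcal F_1$ with $x_{bj}^3-x_{bj}$ replaced by $x_{bj}^2-x_{bj}$ ($1\le j\le n$); $\tilde{\mathcal F}_2$ = $\mathcal F_2$ with the polynomials $x_{bj}-\nu_j$ removed; $\mathcal F_3$ = for each unit triangle, the sum of its three side variables; $\mathcal F_4$ = for each upward (downward) unit triangle, the upward (downward) distinguishing polynomial evaluated at its side variables; $\mathcal F_5$ = for each unit rhombus inside the big triangle of left/right/bottom type, the corresponding forbidding polynomial evaluated at its four boundary variables; $\mathcal F_6$ = for each implicit piece $\overline p$ and each translate inside the big triangle of the polygon shape of $\Omega_b$, $f_{\overline p}$ evaluated at the $m$ variables of that polygon. The puzzle ideal is $I^{\nu,\Omega}_{\lambda\mu}=\langle\mathcal F_1\cup\dots\cup\mathcal F_6\rangle$ and the $\nu$-free puzzle ideal is $I^{\emptyset,\Omega}_{\lambda\mu}=\langle\tilde{\mathcal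 F}_1\cup\tilde{\mathcal F}_2\cup\mathcal F_3\cup\dots\cup\mathcal F_6\rangle$, both in $\mathbb{F}_3[\boldsymbol x]$. $V(I^{\emptyset,\Omega})$ is the set of common zeros in $\mathbb{F}_3^n$; the prime corresponding to $\overline\nu_k$ is $\langle x_{b1}-\overline\nu_{k1},\dots,x_{bn}-\overline\nu_{kn}\rangle$. *)

theory Defs
  imports
    "HOL-Analysis.Convex"
    "HOL-Algebra.Ideal"
    "HOL-Library.Poly_Mapping"
    "HOL-Library.Numeral_Type"
begin

section \<open>Polynomials over the field with three elements\<close>

type_synonym F3 = "3"

text \<open>Elements of the subfield with two elements are identified with \<open>0\<close> and \<open>1\<close> in \<open>F3\<close>.\<close>

definition F2 :: "F3 set" where
  "F2 = {0, 1}"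

text \<open>A monomial is a finitely supported exponent vector, a polynomial is a finitely supported
  family of coefficients indexed by monomials; the product of \<^theory>\<open>HOL-Library.Poly_Mapping\<close>
  is the usual product of polynomials.\<close>

type_synonym 'v F3_poly = "('v \<Rightarrow>\<^sub>0 nat) \<Rightarrow>\<^sub>0 F3"

definition Const :: "F3 \<Rightarrow> 'v F3_poly" where
  "Const c = Poly_Mapping.single 0 c"

definition Var :: "'v \<Rightarrow> 'v F3_poly" where
  "Var v = Poly_Mapping.single (Poly_Mapping.single v 1) 1"

definition poly_vars :: "'v F3_poly \<Rightarrow> 'v set" where
  "poly_vars p = (\<Union>m \<in> Poly_Mapping.keys p. Poly_Mapping.keys m)"

definition poly_ring :: "'v set \<Rightarrow> 'v F3_poly ring" where
  "poly_ring X =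
     \<lparr>carrier = {p. poly_vars p \<subseteq> X}, mult = (*), one = 1, zero = 0, add = (+)\<rparr>"

definition poly_hom :: "(F3 \<Rightarrow> 'r::comm_ring_1) \<Rightarrow> ('v \<Rightarrow> 'r) \<Rightarrow> 'v F3_poly \<Rightarrow> 'r" where
  "poly_hom h g p = (\<Sum>m \<in> Poly_Mapping.keys p.
     h (Poly_Mapping.lookup p m) *
       (\<Prod>v \<in> Poly_Mapping.keys m. g v ^ Poly_Mapping.lookup m v))"

abbreviation poly_eval :: "('v \<Rightarrow> F3) \<Rightarrow> 'v F3_poly \<Rightarrow> F3" where
  "poly_eval \<equiv> poly_hom id"

abbreviation poly_subst :: "('v \<Rightarrow> 'w) \<Rightarrow> 'v F3_poly \<Rightarrow> 'w F3_poly" where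
  "poly_subst s \<equiv> poly_hom Const (\<lambda>v. Var (s v))"

definition radical :: "('a, 'b) ring_scheme \<Rightarrow> 'a set \<Rightarrow> 'a set" where
  "radical R I = {a \<in> carrier R. \<exists>m::nat. a [^]\<^bsub>R\<^esub> m \<in> I}"

definition radical_ideal :: "'a set \<Rightarrow> ('a, 'b) ring_scheme \<Rightarrow> bool" where
  "radical_ideal I R \<longleftrightarrow> ideal I R \<and> radical R I = I"

text \<open>An irredundant representation as a finite intersection of primes. The unit ideal is
  the empty intersection.\<close>

definition prime_decomposition ::
    "('a, 'b) ring_scheme \<Rightarrow> 'a set \<Rightarrow> 'a set set \<Rightarrow> bool" where
  "prime_decomposition R I P \<longleftrightarrow>
     finite P \<and> (\<forall>p\<in>P. primeideal p R) \<and> I = carrier R \<inter> \<Inter>P \<and>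
     (\<forall>p\<in>P. carrier R \<inter> \<Inter>(P - {p}) \<noteq> I)"


section \<open>The triangular lattice\<close>

text \<open>The lattice point \<open>(a, b)\<close> is \<open>a e\<^sub>1 + b e\<^sub>2\<close>, where \<open>e\<^sub>1\<close> is the unit vector along the
  bottom side of the big triangle and \<open>e\<^sub>2\<close> the one along its left side, pointing upwards.
  A unit interval is given by the side it is parallel to and its position:
  \<open>(Lft, a, b)\<close> joins \<open>(a, b)\<close> and \<open>(a, b + 1)\<close>,
  \<open>(Rgt, a, b)\<close> joins \<open>(a + 1, b)\<close> and \<open>(a, b + 1)\<close>,
  \<open>(Bot, a, b)\<close> joins \<open>(a, b)\<close> and \<open>(a + 1, b)\<close>.
  \<open>Up a b\<close> has the vertices \<open>(a, b)\<close>, \<open>(a + 1, b)\<close>, \<open>(a, b + 1)\<close>, and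
  \<open>Down a b\<close> has the vertices \<open>(a + 1, b)\<close>, \<open>(a, b + 1)\<close>, \<open>(a + 1, b + 1)\<close>.\<close>

datatype dir = Lft | Rgt | Bot

type_synonym interval = "dir \<times> int \<times> int"

datatype cell = Up (cell_x: int) (cell_y: int) | Down (cell_x: int) (cell_y: int)

text \<open>Listed in the order left, right, bottom for \<open>Up\<close> and left, top, right for \<open>Down\<close>.\<close>

fun cell_sides :: "cell \<Rightarrow> interval list" where
  "cell_sides (Up a b) = [(Lft, a, b), (Rgt, a, b), (Bot, a, b)]"
| "cell_sides (Down a b) = [(Rgt, a, b), (Bot, a, b + 1), (Lft, a + 1, b)]"

definition intervals :: "cell set \<Rightarrow> interval set" where
  "intervals S = (\<Union>c\<in>S. set (cell_sides c))"

definition boundary :: "cell set \<Rightarrow> interval set" where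
  "boundary S = {i. \<exists>!c. c \<in> S \<and> i \<in> set (cell_sides c)}"

text \<open>The rhombus with middle interval \<open>m\<close>, and its sides in the order top, right, bottom, left
  (middle interval parallel to the left or right side), respectively NW, NE, SE, SW (middle
  interval parallel to the bottom side).\<close>

fun rhombus :: "interval \<Rightarrow> cell set" where
  "rhombus (Lft, a, b) = {Up a b, Down (a - 1) b}"
| "rhombus (Rgt, a, b) = {Up a b, Down a b}"
| "rhombus (Bot, a, b) = {Up a b, Down a (b - 1)}"

fun rhombus_sides :: "interval \<Rightarrow> interval list" where
  "rhombus_sides (Lft, a, b) = [(Bot, a - 1, b + 1), (Rgt, a, b), (Bot, a, b), (Rgt, a - 1, b)]"
| "rhombus_sides (Rgt, a, b) = [(Bot, a, b + 1), (Lft, a + 1, b), (Bot, a, b), (Lft, a, b)]"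
| "rhombus_sides (Bot, a, b) = [(Lft, a, b), (Rgt, a, b), (Lft, a + 1, b - 1), (Rgt, a, b - 1)]"

definition unit_triangle :: "cell set \<Rightarrow> bool" where
  "unit_triangle S \<longleftrightarrow> (\<exists>c. S = {c})"

definition unit_rhombus :: "cell set \<Rightarrow> bool" where
  "unit_rhombus S \<longleftrightarrow> (\<exists>m. S = rhombus m)"

text \<open>Regions are taken in the coordinates with respect to \<open>e\<^sub>1, e\<^sub>2\<close>; convexity is
  invariant under this linear change of coordinates.\<close>

fun cell_region :: "cell \<Rightarrow> (real \<times> real) set" where
  "cell_region (Up a b) =
     convex hull {(real_of_int a, real_of_int b), (real_of_int a + 1, real_of_int b),
                  (real_of_int a, real_of_int b + 1)}"
| "cell_region (Down a b) =
     convex hull {(real_of_int a + 1, real_of_int b), (real_of_int a, real_of_int b + 1),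
                  (real_of_int a + 1, real_of_int b + 1)}"

text \<open>A convex polygon whose sides are lattice directed and of integer length is, up to
  translation, the same as a convex union of finitely many unit triangles.\<close>

definition convex_polygon :: "cell set \<Rightarrow> bool" where
  "convex_polygon S \<longleftrightarrow> finite S \<and> S \<noteq> {} \<and> convex (\<Union>c\<in>S. cell_region c)"

fun shift_interval :: "int \<times> int \<Rightarrow> interval \<Rightarrow> interval" where
  "shift_interval (u, v) (d, a, b) = (d, a + u, b + v)"

fun shift_cell :: "int \<times> int \<Rightarrow> cell \<Rightarrow> cell" where
  "shift_cell (u, v) (Up a b) = Up (a + u) (b + v)"
| "shift_cell (u, v) (Down a b) = Down (a + u) (b + v)"

definition big_triangle :: "nat \<Rightarrow> cell set" where
  "big_triangle n =
     {Up a b |a b. 0 \<le> a \<and> 0 \<le> b \<and> a + b \<le> int n - 1} \<union>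
     {Down a b |a b. 0 \<le> a \<and> 0 \<le> b \<and> a + b \<le> int n - 2}"

text \<open>The \<open>j\<close>-th intervals of the three sides, read from left to right and counted from \<open>0\<close>.\<close>

definition left_side :: "nat \<Rightarrow> nat \<Rightarrow> interval" where
  "left_side n j = (Lft, 0, int j)"

definition right_side :: "nat \<Rightarrow> nat \<Rightarrow> interval" where
  "right_side n j = (Rgt, int j, int n - 1 - int j)"

definition bottom_side :: "nat \<Rightarrow> nat \<Rightarrow> interval" where
  "bottom_side n j = (Bot, int j, 0)"


section \<open>Pieces and tilings\<close>

text \<open>A polygon in the plane with values on its boundary intervals. Pieces, which matter only up
  to translation, are represented by their unique translate for which both minimal cell
  coordinates are \<open>0\<close>.\<close>

type_synonym placed_piece = "cell set \<times> (interval \<rightharpoonup> F3)"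

definition is_placed_piece :: "placed_piece \<Rightarrow> bool" where
  "is_placed_piece q \<longleftrightarrow> convex_polygon (fst q) \<and> dom (snd q) = boundary (fst q)"

definition shift_piece :: "int \<times> int \<Rightarrow> placed_piece \<Rightarrow> placed_piece" where
  "shift_piece d q =
     (shift_cell d ` fst q, \<lambda>i. snd q (shift_interval (- fst d, - snd d) i))"

definition piece_of :: "placed_piece \<Rightarrow> placed_piece" where
  "piece_of q = shift_piece (- Min (cell_x ` fst q), - Min (cell_y ` fst q)) q"

definition is_piece :: "placed_piece \<Rightarrow> bool" where
  "is_piece p \<longleftrightarrow> is_placed_piece p \<and> piece_of p = p"

definition F2_valued :: "placed_piece \<Rightarrow> bool" where
  "F2_valued q \<longleftrightarrow> ran (snd q) \<subseteq> F2"

definition is_tiling ::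
    "placed_piece set \<Rightarrow> cell set \<Rightarrow> (interval \<rightharpoonup> F3) \<Rightarrow> placed_piece set \<Rightarrow> bool" where
  "is_tiling Om S w t \<longleftrightarrow>
     (\<forall>q\<in>t. is_placed_piece q \<and> piece_of q \<in> Om) \<and>
     (\<forall>q\<in>t. \<forall>q'\<in>t. q \<noteq> q' \<longrightarrow> fst q \<inter> fst q' = {}) \<and>
     (\<Union>q\<in>t. fst q) = S \<and>
     (\<forall>q\<in>t. \<forall>q'\<in>t. \<forall>i \<in> dom (snd q) \<inter> dom (snd q'). snd q i = snd q' i) \<and>
     (\<forall>q\<in>t. \<forall>i \<in> dom (snd q) \<inter> dom w. snd q i = w i)"

definition has_tiling :: "placed_piece set \<Rightarrow> placed_piece \<Rightarrow> bool" where
  "has_tiling Om p \<longleftrightarrow> (\<exists>t. is_tiling Om (fst p) (snd p) t)"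

definition pieces_in :: "placed_piece set \<Rightarrow> placed_piece set" where
  "pieces_in t = piece_of ` t"

text \<open>A set of puzzle pieces is the disjoint union of its unit triangles, its unit rhombuses and
  its big pieces, and the big pieces all have the same shape.\<close>

definition big_pieces :: "placed_piece set \<Rightarrow> placed_piece set" where
  "big_pieces Om = {p \<in> Om. \<not> unit_triangle (fst p) \<and> \<not> unit_rhombus (fst p)}"

definition puzzle_pieces :: "placed_piece set \<Rightarrow> bool" where
  "puzzle_pieces Om \<longleftrightarrow>
     (\<forall>p\<in>Om. is_piece p \<and> F2_valued p) \<and>
     (\<forall>p\<in>big_pieces Om. \<forall>q\<in>big_pieces Om. fst p = fst q)"


section \<open>Atomic refinements\<close>

definition cell_values :: "(interval \<rightharpoonup> F3) \<Rightarrow> cell \<Rightarrow> F3 list" where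
  "cell_values w c = map (\<lambda>i. the (w i)) (cell_sides c)"

definition rhombus_values :: "(interval \<rightharpoonup> F3) \<Rightarrow> interval \<Rightarrow> F3 list" where
  "rhombus_values w m = map (\<lambda>i. the (w i)) (rhombus_sides m)"

definition atomic_pieces :: "placed_piece set" where
  "atomic_pieces =
     {p. is_piece p \<and> (\<exists>c. fst p = {c} \<and> sum_list (cell_values (snd p) c) = 0)}"

definition regular :: "placed_piece \<Rightarrow> bool" where
  "regular q \<longleftrightarrow> piece_of q \<in> atomic_pieces \<and> ran (snd q) \<notin> {{0}, {1}, {2}}"

text \<open>\<open>tb p\<close> is the chosen tiling of \<open>p \<in> Om\<close> with atomic pieces.\<close>

definition refining_tilings ::
    "placed_piece set \<Rightarrow> (placed_piece \<Rightarrow> placed_piece set) \<Rightarrow> bool" where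
  "refining_tilings Om tb \<longleftrightarrow> (\<forall>p\<in>Om. is_tiling atomic_pieces (fst p) (snd p) (tb p))"

definition refinement ::
    "placed_piece set \<Rightarrow> (placed_piece \<Rightarrow> placed_piece set) \<Rightarrow> placed_piece set" where
  "refinement Om tb = (\<Union>p\<in>Om. pieces_in (tb p))"

definition stitchable :: "placed_piece set \<Rightarrow> placed_piece \<Rightarrow> placed_piece \<Rightarrow> bool" where
  "stitchable t q q' \<longleftrightarrow>
     q \<in> t \<and> q' \<in> t \<and> q \<noteq> q' \<and> regular q \<and> regular q' \<and>
     (\<exists>i. snd q i = Some 2 \<and> snd q' i = Some 2)"

definition merge :: "placed_piece \<Rightarrow> placed_piece \<Rightarrow> placed_piece" where
  "merge q q' = (fst q \<union> fst q', (snd q ++ snd q') |` boundary (fst q \<union> fst q'))"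

definition stitching :: "placed_piece set \<Rightarrow> placed_piece set" where
  "stitching t =
     {q \<in> t. \<not> (\<exists>q'. stitchable t q q')} \<union> {merge q q' |q q'. stitchable t q q'}"

definition implicit_wrt ::
    "placed_piece set \<Rightarrow> (placed_piece \<Rightarrow> placed_piece set) \<Rightarrow> placed_piece \<Rightarrow> placed_piece set"
  where "implicit_wrt Om tb p = pieces_in (stitching (tb p)) - Om"

definition implicit_pieces ::
    "placed_piece set \<Rightarrow> (placed_piece \<Rightarrow> placed_piece set) \<Rightarrow> placed_piece set" where
  "implicit_pieces Om tb = (\<Union>p \<in> big_pieces Om. implicit_wrt Om tb p)"

definition separable ::
    "placed_piece set \<Rightarrow> (placed_piece \<Rightarrow> placed_piece set) \<Rightarrow> bool" where
  "separable Om tb \<longleftrightarrow>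
     (\<forall>p \<in> big_pieces Om. \<forall>a \<in> implicit_wrt Om tb p.
        \<exists>!q. q \<in> stitching (tb p) \<and> piece_of q = a) \<and>
     (\<forall>p \<in> big_pieces Om. \<forall>p' \<in> big_pieces Om. p \<noteq> p' \<longrightarrow>
        implicit_wrt Om tb p \<inter> implicit_wrt Om tb p' = {})"

definition forbidden_pieces ::
    "placed_piece set \<Rightarrow> (placed_piece \<Rightarrow> placed_piece set) \<Rightarrow> placed_piece set" where
  "forbidden_pieces Om tb =
     {p. is_piece p \<and> unit_rhombus (fst p) \<and> F2_valued p \<and>
         has_tiling (refinement Om tb) p \<and> \<not> has_tiling Om p}
     - implicit_pieces Om tb"

text \<open>Implying polynomials are attached only to implicit pieces of these two kinds. A regular
  triangle next to a \<open>(2,2,2)\<close>-valued one survives stitching and is implicit, but it is not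
  expected to determine a big piece.\<close>

definition implying_kind :: "placed_piece \<Rightarrow> bool" where
  "implying_kind a \<longleftrightarrow>
     unit_triangle (fst a) \<and> ran (snd a) = {2} \<or> unit_rhombus (fst a) \<and> F2_valued a"


section \<open>Distinguishing, forbidding and implying polynomials\<close>

text \<open>Elements of the quotients by \<open>z\<^sup>3 - z\<close> are given by arbitrary representatives. The ideals
  below contain \<open>x\<^sup>3 - x\<close> for every variable \<open>x\<close> (the polynomial \<open>x\<^sup>2 - x\<close> divides it) and
  therefore do not depend on the representatives.\<close>

definition distinguishing :: "placed_piece set \<Rightarrow> cell \<Rightarrow> nat F3_poly \<Rightarrow> bool" where
  "distinguishing Ob c f \<longleftrightarrow>
     f \<in> carrier (poly_ring {..<3}) \<and>
     (\<forall>a \<in> atomic_pieces. fst a = {c} \<longrightarrow>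
        (poly_eval (\<lambda>l. cell_values (snd a) c ! l) f = 0 \<longleftrightarrow> a \<in> Ob))"

definition forbidding ::
    "placed_piece set \<Rightarrow> (placed_piece \<Rightarrow> placed_piece set) \<Rightarrow> dir \<Rightarrow> nat F3_poly \<Rightarrow> bool" where
  "forbidding Om tb d f \<longleftrightarrow>
     f \<in> carrier (poly_ring {..<4}) \<and>
     (\<forall>p x y. is_piece p \<and> fst p = rhombus (d, x, y) \<and> has_tiling (refinement Om tb) p \<longrightarrow>
        (poly_eval (\<lambda>l. rhombus_values (snd p) (d, x, y) ! l) f \<noteq> 0
           \<longleftrightarrow> p \<in> forbidden_pieces Om tb))"

definition tiling_value :: "placed_piece set \<Rightarrow> interval \<Rightarrow> F3" where
  "tiling_value t i = (THE c. \<exists>q\<in>t. snd q i = Some c)"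

text \<open>Here the variables \<open>z\<^sub>1, \<dots>, z\<^sub>m\<close> are the intervals of the polygon of \<open>p\<close> themselves. The
  piece \<open>q\<close> is the occurrence of the implicit piece in the stitching of \<open>tb p\<close>.\<close>

definition implying ::
    "(placed_piece \<Rightarrow> placed_piece set) \<Rightarrow> placed_piece \<Rightarrow> placed_piece \<Rightarrow> interval F3_poly \<Rightarrow> bool"
  where
  "implying tb p q f \<longleftrightarrow>
     f \<in> carrier (poly_ring (intervals (fst p))) \<and>
     poly_eval (tiling_value (tb p)) f = 0 \<and>
     (\<forall>z. (\<exists>i \<in> intervals (fst p). z i \<noteq> tiling_value (tb p) i) \<and>
          (\<forall>i \<in> boundary (fst q). z i = tiling_value (tb p) i) \<longrightarrow> poly_eval z f = 1)"

record poly_choice =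
  up_poly :: "nat F3_poly"
  down_poly :: "nat F3_poly"
  forb_poly :: "dir \<Rightarrow> nat F3_poly"
  impl_poly :: "placed_piece \<Rightarrow> interval F3_poly"

definition valid_choice ::
    "placed_piece set \<Rightarrow> (placed_piece \<Rightarrow> placed_piece set) \<Rightarrow> poly_choice \<Rightarrow> bool" where
  "valid_choice Om tb C \<longleftrightarrow>
     distinguishing (refinement Om tb) (Up 0 0) (up_poly C) \<and>
     distinguishing (refinement Om tb) (Down 0 0) (down_poly C) \<and>
     (\<forall>d. forbidding Om tb d (forb_poly C d)) \<and>
     (\<forall>p \<in> big_pieces Om. \<forall>q \<in> stitching (tb p).
        piece_of q \<in> implicit_wrt Om tb p \<and> implying_kind (piece_of q) \<longrightarrow>
        implying tb p q (impl_poly C (piece_of q)))"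


section \<open>Puzzle ideals\<close>

abbreviation puzzle_vars :: "nat \<Rightarrow> interval set" where
  "puzzle_vars n \<equiv> intervals (big_triangle n)"

definition bottom_vars :: "nat \<Rightarrow> interval set" where
  "bottom_vars n = bottom_side n ` {..<n}"

definition gens_1 :: "nat \<Rightarrow> interval F3_poly set" where
  "gens_1 n = {Var i ^ 3 - Var i |i. i \<in> puzzle_vars n}"

definition free_gens_1 :: "nat \<Rightarrow> interval F3_poly set" where
  "free_gens_1 n =
     {Var i ^ 3 - Var i |i. i \<in> puzzle_vars n - bottom_vars n} \<union>
     {Var i ^ 2 - Var i |i. i \<in> bottom_vars n}"

definition bottom_gens :: "nat \<Rightarrow> F3 list \<Rightarrow> interval F3_poly set" where
  "bottom_gens n nu = {Var (bottom_side n j) - Const (nu ! j) |j. j < n}"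

definition free_gens_2 :: "nat \<Rightarrow> F3 list \<Rightarrow> F3 list \<Rightarrow> interval F3_poly set" where
  "free_gens_2 n lam mu =
     {Var (left_side n j) - Const (lam ! j) |j. j < n} \<union>
     {Var (right_side n j) - Const (mu ! j) |j. j < n}"

definition gens_2 :: "nat \<Rightarrow> F3 list \<Rightarrow> F3 list \<Rightarrow> F3 list \<Rightarrow> interval F3_poly set" where
  "gens_2 n lam mu nu = free_gens_2 n lam mu \<union> bottom_gens n nu"

definition gens_3 :: "nat \<Rightarrow> interval F3_poly set" where
  "gens_3 n = {sum_list (map Var (cell_sides c)) |c. c \<in> big_triangle n}"

definition gens_4 :: "nat \<Rightarrow> poly_choice \<Rightarrow> interval F3_poly set" where
  "gens_4 n C =
     {poly_subst (\<lambda>l. cell_sides (Up a b) ! l) (up_poly C) |a b. Up a b \<in> big_triangle n} \<union>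
     {poly_subst (\<lambda>l. cell_sides (Down a b) ! l) (down_poly C) |a b. Down a b \<in> big_triangle n}"

definition gens_5 :: "nat \<Rightarrow> poly_choice \<Rightarrow> interval F3_poly set" where
  "gens_5 n C =
     {poly_subst (\<lambda>l. rhombus_sides (d, a, b) ! l) (forb_poly C d) |d a b.
        rhombus (d, a, b) \<subseteq> big_triangle n}"

definition gens_6 ::
    "nat \<Rightarrow> placed_piece set \<Rightarrow> (placed_piece \<Rightarrow> placed_piece set) \<Rightarrow> poly_choice \<Rightarrow>
      interval F3_poly set" where
  "gens_6 n Om tb C =
     {poly_subst (shift_interval e) (impl_poly C a) |p a e.
        p \<in> big_pieces Om \<and> a \<in> implicit_wrt Om tb p \<and> implying_kind a \<and>
        shift_cell e ` fst p \<subseteq> big_triangle n}"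

definition puzzle_ideal ::
    "nat \<Rightarrow> F3 list \<Rightarrow> F3 list \<Rightarrow> F3 list \<Rightarrow>
      placed_piece set \<Rightarrow> (placed_piece \<Rightarrow> placed_piece set) \<Rightarrow> poly_choice \<Rightarrow>
      interval F3_poly set" where
  "puzzle_ideal n lam mu nu Om tb C =
     Idl\<^bsub>poly_ring (puzzle_vars n)\<^esub>
       (gens_1 n \<union> gens_2 n lam mu nu \<union> gens_3 n \<union> gens_4 n C \<union> gens_5 n C \<union> gens_6 n Om tb C)"

definition free_puzzle_ideal ::
    "nat \<Rightarrow> F3 list \<Rightarrow> F3 list \<Rightarrow>
      placed_piece set \<Rightarrow> (placed_piece \<Rightarrow> placed_piece set) \<Rightarrow> poly_choice \<Rightarrow>
      interval F3_poly set" where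
  "free_puzzle_ideal n lam mu Om tb C =
     Idl\<^bsub>poly_ring (puzzle_vars n)\<^esub>
       (free_gens_1 n \<union> free_gens_2 n lam mu \<union> gens_3 n \<union> gens_4 n C \<union> gens_5 n C \<union> gens_6 n Om tb C)"

definition elimination_ideal ::
    "nat \<Rightarrow> F3 list \<Rightarrow> F3 list \<Rightarrow>
      placed_piece set \<Rightarrow> (placed_piece \<Rightarrow> placed_piece set) \<Rightarrow> poly_choice \<Rightarrow>
      interval F3_poly set" where
  "elimination_ideal n lam mu Om tb C =
     free_puzzle_ideal n lam mu Om tb C \<inter> carrier (poly_ring (bottom_vars n))"

definition point_ideal :: "nat \<Rightarrow> F3 list \<Rightarrow> interval F3_poly set" where
  "point_ideal n nu = Idl\<^bsub>poly_ring (bottom_vars n)\<^esub> (bottom_gens n nu)"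

text \<open>The assignment gives \<open>bottom_side n j\<close> the value \<open>nu ! j\<close>; only these variables occur.\<close>

definition bottom_variety :: "nat \<Rightarrow> interval F3_poly set \<Rightarrow> F3 list set" where
  "bottom_variety n I =
     {nu. length nu = n \<and> (\<forall>f\<in>I. poly_eval (\<lambda>(d, a, b). nu ! nat a) f = 0)}"

definition binary_seq :: "nat \<Rightarrow> F3 list \<Rightarrow> bool" where
  "binary_seq n xs \<longleftrightarrow> length xs = n \<and> set xs \<subseteq> F2"

end

theory Submission
  imports Defs
begin

text \<open>The elimination ideal contains \<open>Var v ^ 2 - Var v\<close> for every bottom variable, so every
  prime above it contains \<open>Var v\<close> or \<open>Var v - 1\<close> for each \<open>v\<close> and hence contains, and by maximality
  equals, the ideal of a binary point. The same factorisation, applied through colon ideals, gives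
  for each \<open>f\<close> outside the elimination ideal a binary point of its variety at which \<open>f\<close> does not
  vanish. Hence the elimination ideal is the intersection of finitely many pairwise incomparable
  primes. The last claim compares generators: modulo \<open>Var v ^ 2 - Var v\<close> the cubic field equations
  are redundant, and \<open>Var v - c\<close> with \<open>c \<in> F2\<close> divides \<open>Var v ^ 2 - Var v\<close>.\<close>


section \<open>Polynomial rings\<close>

lemma F3_cases: "x = 0 \<or> x = 1 \<or> x = 2" for x :: F3
proof (cases x)
  case (of_int z)
  then have "0 \<le> z" "z < 3" by simp_all
  then have "z = 0 \<or> z = 1 \<or> z = 2" by arith
  then show ?thesis using of_int by auto
qed

text \<open>The nonzero elements are \<open>1\<close> and \<open>2 = - 1\<close>, so each is its own
  inverse. This provides the inverses in \<open>F3\<close> used below.\<close>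

lemma F3_square: "x * x = 1" if "x \<noteq> 0" for x :: F3
  using F3_cases[of x] that by auto

lemma F3_no_zero_divisors: "x = 0 \<or> y = 0" if "x * y = 0" for x y :: F3
proof (rule ccontr)
  assume "\<not> ?thesis"
  then have "(x * x) * (y * y) = 1" by (simp add: F3_square)
  moreover have "(x * x) * (y * y) = (x * y) * (x * y)" by (simp add: ac_simps)
  ultimately show False using that by simp
qed

text \<open>The remaining element has \<open>2 ^ 2 - 2 = 2\<close>. In this form, binary values can
  be read off from the equations \<open>Var v ^ 2 - Var v\<close>.\<close>

lemma F2_iff: "x \<in> F2 \<longleftrightarrow> x ^ 2 - x = 0" for x :: F3
  using F3_cases[of x] by (auto simp: F2_def)

section \<open>Closure properties and ring structure of polynomial rings\<close>

lemma poly_ring_simps [simp]: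
  "mult (poly_ring X) = (*)" "one (poly_ring X) = 1"
  "zero (poly_ring X) = 0" "add (poly_ring X) = (+)"
  by (simp_all add: poly_ring_def)

lemma poly_ring_carrier_iff: "p \<in> carrier (poly_ring X) \<longleftrightarrow> poly_vars p \<subseteq> X"
  by (simp add: poly_ring_def)

lemma poly_ring_carrier_mono: "X \<subseteq> Y \<Longrightarrow> carrier (poly_ring X) \<subseteq> carrier (poly_ring Y)"
  by (auto simp: poly_ring_def)

lemma poly_ring_zero [simp]: "0 \<in> carrier (poly_ring X)"
  and poly_ring_one [simp]: "1 \<in> carrier (poly_ring X)"
  and poly_ring_Const [simp]: "Const c \<in> carrier (poly_ring X)"
  and poly_ring_Var [simp]: "Var v \<in> carrier (poly_ring X) \<longleftrightarrow> v \<in> X"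
  by (auto simp: poly_ring_carrier_iff poly_vars_def Const_def Var_def split: if_splits)

lemma poly_ring_add [simp]:
  assumes "p \<in> carrier (poly_ring X)" "q \<in> carrier (poly_ring X)"
  shows "p + q \<in> carrier (poly_ring X)"
  using assms keys_add[of p q] unfolding poly_ring_carrier_iff poly_vars_def by blast

lemma poly_ring_mult [simp]:
  assumes "p \<in> carrier (poly_ring X)" "q \<in> carrier (poly_ring X)"
  shows "p * q \<in> carrier (poly_ring X)"
proof -
  have "v \<in> X" if m: "m \<in> Poly_Mapping.keys (p * q)" and v: "v \<in> Poly_Mapping.keys m" for m v
  proof -
    obtain a b where "m = a + b" "a \<in> Poly_Mapping.keys p" "b \<in> Poly_Mapping.keys q"
      using m keys_mult[of p q] by blast
    then show ?thesis
      using v keys_add[of a b] assms unfolding poly_ring_carrier_iff poly_vars_def by blast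
  qed
  then show ?thesis by (auto simp: poly_ring_carrier_iff poly_vars_def)
qed

lemma poly_ring_uminus [simp]:
  "p \<in> carrier (poly_ring X) \<Longrightarrow> - p \<in> carrier (poly_ring X)"
  by (simp add: poly_ring_carrier_iff poly_vars_def in_keys_iff)

lemma poly_ring_diff [simp]:
  assumes "p \<in> carrier (poly_ring X)" "q \<in> carrier (poly_ring X)"
  shows "p - q \<in> carrier (poly_ring X)"
  using poly_ring_add[OF assms(1) poly_ring_uminus[OF assms(2)]] by simp

lemma poly_ring_power [simp]:
  "p \<in> carrier (poly_ring X) \<Longrightarrow> p ^ k \<in> carrier (poly_ring X)"
  by (induction k) simp_all

lemma poly_ring_sum:
  "(\<And>a. a \<in> A \<Longrightarrow> f a \<in> carrier (poly_ring X)) \<Longrightarrow> sum f A \<in> carrier (poly_ring X)"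
  by (induction A rule: infinite_finite_induct) simp_all

lemma poly_ring_prod:
  "(\<And>a. a \<in> A \<Longrightarrow> f a \<in> carrier (poly_ring X)) \<Longrightarrow> prod f A \<in> carrier (poly_ring X)"
  by (induction A rule: infinite_finite_induct) simp_all

lemma poly_ring_sum_list:
  "set ps \<subseteq> carrier (poly_ring X) \<Longrightarrow> sum_list ps \<in> carrier (poly_ring X)"
  by (induction ps) simp_all

lemma poly_subst_in_poly_ring:
  assumes "p \<in> carrier (poly_ring X)" and "s ` X \<subseteq> Y"
  shows "poly_subst s p \<in> carrier (poly_ring Y)"
proof -
  have "s v \<in> Y" if "m \<in> Poly_Mapping.keys p" "v \<in> Poly_Mapping.keys m" for m v
    using that assms by (auto simp: poly_ring_carrier_iff poly_vars_def)
  then show ?thesis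
    unfolding poly_hom_def by (intro poly_ring_sum poly_ring_mult poly_ring_prod) simp_all
qed

lemma Const_0 [simp]: "Const 0 = 0"
  and Const_1 [simp]: "Const 1 = 1"
  and Const_add: "Const (a + b) = Const a + Const b"
  and Const_mult: "Const (a * b) = Const a * Const b"
  by (simp_all add: Const_def single_add mult_single)

lemma cring_poly_ring: "cring (poly_ring X)"
proof (rule cringI)
  show "abelian_group (poly_ring X)"
  proof (rule abelian_groupI)
    fix p assume "p \<in> carrier (poly_ring X)"
    then show "\<exists>q\<in>carrier (poly_ring X). q \<oplus>\<^bsub>poly_ring X\<^esub> p = \<zero>\<^bsub>poly_ring X\<^esub>"
      by (intro bexI[of _ "- p"]) simp_all
  qed (simp_all add: ac_simps)
  show "Group.comm_monoid (poly_ring X)"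
    by (rule comm_monoidI) (simp_all add: ac_simps)
qed (simp_all add: algebra_simps)

text \<open>The ring is generated by constants and variables: the elements satisfying
  \<open>P\<close> are closed under sums and products, so they include all monomials and then all
  sums of monomials.\<close>

lemma poly_ring_induct [consumes 1, case_names Const Var add mult]:
  assumes p: "p \<in> carrier (poly_ring X)"
    and C: "\<And>c. P (Const c)" and V: "\<And>v. v \<in> X \<Longrightarrow> P (Var v)"
    and add: "\<And>p q. p \<in> carrier (poly_ring X) \<Longrightarrow> q \<in> carrier (poly_ring X) \<Longrightarrow>
      P p \<Longrightarrow> P q \<Longrightarrow> P (p + q)"
    and mult: "\<And>p q. p \<in> carrier (poly_ring X) \<Longrightarrow> q \<in> carrier (poly_ring X) \<Longrightarrow>
      P p \<Longrightarrow> P q \<Longrightarrow> P (p * q)"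
  shows "P p"
proof -
  define S where "S = {p \<in> carrier (poly_ring X). P p}"
  have S_C: "Const c \<in> S" for c using C by (simp add: S_def)
  have S_add: "p + q \<in> S" if "p \<in> S" "q \<in> S" for p q using that add by (simp add: S_def)
  have S_mult: "p * q \<in> S" if "p \<in> S" "q \<in> S" for p q using that mult by (simp add: S_def)
  have S_0: "0 \<in> S" and S_1: "1 \<in> S" using S_C[of 0] S_C[of 1] by simp_all
  have S_sum: "sum f A \<in> S" if "\<And>a. a \<in> A \<Longrightarrow> f a \<in> S" for f :: "('a \<Rightarrow>\<^sub>0 nat) \<Rightarrow> 'a F3_poly" and A
    using that by (induction A rule: infinite_finite_induct) (simp_all add: S_0 S_add)
  have monom: "Poly_Mapping.single m c \<in> S" if "Poly_Mapping.keys m \<subseteq> X" for m c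
    using that
  proof (induction m arbitrary: c rule: update_induct)
    case const
    then show ?case using S_C by (simp add: Const_def)
  next
    case (update m v k)
    \<comment> \<open>The variable \<open>v\<close> does not occur in \<open>m\<close>, so setting
      its exponent to \<open>k\<close> multiplies the monomial by the \<open>k\<close>-th power of
      \<open>v\<close>.\<close>
    have "Poly_Mapping.update v k m = Poly_Mapping.single v k + m"
      using update(1)
      by (intro poly_mapping_eqI)
        (auto simp: lookup_update lookup_add lookup_single in_keys_iff when_def)
    then have *: "Poly_Mapping.single (Poly_Mapping.update v k m) c =
        Poly_Mapping.single (Poly_Mapping.single v k) 1 * Poly_Mapping.single m c"
      by (simp add: mult_single)
    have v: "v \<in> X" and m: "Poly_Mapping.keys m \<subseteq> X"
      using update by (auto simp: keys_update)
    have "Poly_Mapping.single (Poly_Mapping.single v j) 1 \<in> S" for j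
    proof (induction j)
      case 0
      then show ?case using S_1 by simp
    next
      case (Suc j)
      have "Poly_Mapping.single (Poly_Mapping.single v (Suc j)) 1 =
          Var v * Poly_Mapping.single (Poly_Mapping.single v j) (1 :: F3)"
        by (simp add: Var_def mult_single flip: single_add)
      moreover have "Var v \<in> S" using v V by (simp add: S_def)
      ultimately show ?case using Suc S_mult by simp
    qed
    then show ?case using * update.IH[OF m] S_mult by simp
  qed
  have "p = (\<Sum>m\<in>Poly_Mapping.keys p. Poly_Mapping.single m (Poly_Mapping.lookup p m))"
    by (intro poly_mapping_eqI)
      (auto simp: lookup_sum lookup_single when_def in_keys_iff)
  also have "\<dots> \<in> S"
    using p by (intro S_sum monom) (auto simp: poly_ring_carrier_iff poly_vars_def)
  finally show ?thesis by (simp add: S_def)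
qed


section \<open>Evaluation\<close>

text \<open>Terms outside the support contribute \<open>0\<close>. A common finite index set allows
  the evaluations of \<open>p\<close>, \<open>q\<close> and \<open>p + q\<close> to be compared term
  by term.\<close>

lemma poly_eval_superset:
  assumes "finite A" "Poly_Mapping.keys p \<subseteq> A"
  shows "poly_eval z p = (\<Sum>m\<in>A. Poly_Mapping.lookup p m *
    (\<Prod>v\<in>Poly_Mapping.keys m. z v ^ Poly_Mapping.lookup m v))"
  unfolding poly_hom_def id_def using assms
  by (intro sum.mono_neutral_left) (auto simp: in_keys_iff)

lemma poly_eval_0 [simp]: "poly_eval z 0 = 0"
  by (simp add: poly_hom_def)

lemma poly_eval_add [simp]: "poly_eval z (p + q) = poly_eval z p + poly_eval z q"
proof -
  let ?A = "Poly_Mapping.keys p \<union> Poly_Mapping.keys q"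
  have "Poly_Mapping.keys (p + q) \<subseteq> ?A" by (rule keys_add)
  then show ?thesis
    by (simp add: poly_eval_superset[of ?A] lookup_add distrib_right sum.distrib)
qed

lemma poly_eval_single:
  "poly_eval z (Poly_Mapping.single m c) =
    c * (\<Prod>v\<in>Poly_Mapping.keys m. z v ^ Poly_Mapping.lookup m v)"
  by (simp add: poly_hom_def)

lemma poly_eval_Const [simp]: "poly_eval z (Const c) = c"
  and poly_eval_Var [simp]: "poly_eval z (Var v) = z v"
  by (simp_all add: Const_def Var_def poly_eval_single)

lemma poly_eval_1 [simp]: "poly_eval z 1 = 1"
  using poly_eval_Const[of z 1] by simp

lemma poly_eval_diff [simp]: "poly_eval z (p - q) = poly_eval z p - poly_eval z q"
  using poly_eval_add[of z "p - q" q] by simp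

text \<open>A variable missing from a monomial contributes the factor \<open>z v ^ 0 = 1\<close>, so
  all three products may run over the union of the supports, where exponents add.\<close>

lemma monomial_value_add:
  fixes z :: "'v \<Rightarrow> F3"
  shows "(\<Prod>v\<in>Poly_Mapping.keys (a + b). z v ^ Poly_Mapping.lookup (a + b) v) =
    (\<Prod>v\<in>Poly_Mapping.keys a. z v ^ Poly_Mapping.lookup a v) *
    (\<Prod>v\<in>Poly_Mapping.keys b. z v ^ Poly_Mapping.lookup b v)"
proof -
  let ?A = "Poly_Mapping.keys a \<union> Poly_Mapping.keys b"
  have superset: "(\<Prod>v\<in>Poly_Mapping.keys m. z v ^ Poly_Mapping.lookup m v) =
      (\<Prod>v\<in>?A. z v ^ Poly_Mapping.lookup m v)" if "Poly_Mapping.keys m \<subseteq> ?A" for m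
    using that by (intro prod.mono_neutral_left) (auto simp: in_keys_iff)
  show ?thesis
    unfolding superset[OF keys_add] superset[OF Un_upper1] superset[OF Un_upper2]
    by (simp add: lookup_add power_add prod.distrib)
qed

text \<open>Constant and variable left factors are handled first. Induction over the generation of
  the ring, with the right factor arbitrary, then reaches every left factor.\<close>

lemma poly_eval_mult [simp]:
  fixes p q :: "'v F3_poly"
  shows "poly_eval z (p * q) = poly_eval z p * poly_eval z q"
proof -
  have pV: "p \<in> carrier (poly_ring (poly_vars p))"
    by (simp add: poly_ring_carrier_iff)
  have Const: "poly_eval z (Const c * r) = c * poly_eval z r" for c and r :: "'v F3_poly"
  proof -
    have lookup: "Poly_Mapping.lookup (Const c * r) m = c * Poly_Mapping.lookup r m" for m
      unfolding Const_def
      by (subst mult_map_scale_conv_mult[symmetric]) (simp add: Poly_Mapping.map.rep_eq when_def)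
    then have "Poly_Mapping.keys (Const c * r) \<subseteq> Poly_Mapping.keys r"
      by (auto simp: in_keys_iff)
    then show ?thesis
      by (simp add: poly_eval_superset[of "Poly_Mapping.keys r"] lookup sum_distrib_left mult.assoc)
  qed
  \<comment> \<open>The \<open>induction\<close> method unfolds the \<open>id\<close> hidden in \<open>poly_eval\<close>; \<open>flip: id_def\<close> restores it.\<close>
  have Var: "poly_eval z (Var v * r) = z v * poly_eval z r" for v and r :: "'v F3_poly"
  proof (induction r rule: update_induct)
    case (update r m c)
    have "Poly_Mapping.update m c r = Poly_Mapping.single m c + r"
      using update(1)
      by (intro poly_mapping_eqI)
        (auto simp: lookup_update lookup_add lookup_single in_keys_iff when_def)
    then show ?case
      using update.IH
      by (simp add: distrib_left Var_def mult_single poly_eval_single monomial_value_add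
          flip: id_def)
  qed (simp flip: id_def)
  have "poly_eval z (p * r) = poly_eval z p * poly_eval z r" for r
    using pV
  proof (induction p arbitrary: r rule: poly_ring_induct)
    case (add p q)
    then show ?case by (simp add: distrib_right flip: id_def)
  next
    case (mult p q)
    then show ?case by (simp add: mult.assoc flip: id_def)
  qed (simp_all add: Const Var flip: id_def)
  then show ?thesis .
qed

lemma poly_eval_power [simp]: "poly_eval z (p ^ k) = poly_eval z p ^ k"
  by (induction k) (simp_all flip: id_def)


section \<open>Ideals\<close>

text \<open>Closure under negation comes from absorbing \<open>- 1\<close>, and absorption on the
  other side from commutativity.\<close>

lemma ideal_poly_ringI:
  assumes "I \<subseteq> carrier (poly_ring X)" "0 \<in> I"
    and "\<And>p q. p \<in> I \<Longrightarrow> q \<in> I \<Longrightarrow> p + q \<in> I"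
    and mult: "\<And>p q. p \<in> I \<Longrightarrow> q \<in> carrier (poly_ring X) \<Longrightarrow> q * p \<in> I"
  shows "ideal I (poly_ring X)"
proof -
  interpret R: cring "poly_ring X" by (rule cring_poly_ring)
  show ?thesis
  proof (rule idealI)
    show "subgroup I (add_monoid (poly_ring X))"
    proof (rule R.add.subgroupI)
      fix p assume p: "p \<in> I"
      have "- p = - 1 * p" by simp
      then have "- p \<in> I" using mult[OF p, of "- 1"] by simp
      moreover have "\<ominus>\<^bsub>poly_ring X\<^esub> p = - p"
        using p assms(1) by (intro R.minus_equality) auto
      ultimately show "\<ominus>\<^bsub>poly_ring X\<^esub> p \<in> I" by simp
    qed (use assms in auto)
  qed (use assms in \<open>auto simp: R.ring_axioms mult.commute\<close>)
qed

context
  fixes I :: "'v F3_poly set" and X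
  assumes I: "ideal I (poly_ring X)"
begin

interpretation ideal I "poly_ring X" by (rule I)

lemma poly_ideal_carrier: "p \<in> I \<Longrightarrow> p \<in> carrier (poly_ring X)"
  by (rule a_Hcarr)

lemma poly_ideal_0: "0 \<in> I"
  using additive_subgroup.zero_closed[OF is_additive_subgroup] by simp

lemma poly_ideal_add: "p \<in> I \<Longrightarrow> q \<in> I \<Longrightarrow> p + q \<in> I"
  using additive_subgroup.a_closed[OF is_additive_subgroup] by simp

lemma poly_ideal_mult: "p \<in> I \<Longrightarrow> q \<in> carrier (poly_ring X) \<Longrightarrow> q * p \<in> I"
  using I_l_closed by simp

lemma poly_ideal_diff: "p \<in> I \<Longrightarrow> q \<in> I \<Longrightarrow> p - q \<in> I"
  using poly_ideal_add[of p "- 1 * q"] poly_ideal_mult[of q "- 1"] by simp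

lemma poly_ideal_eq_carrier: "1 \<in> I \<Longrightarrow> I = carrier (poly_ring X)"
  using one_imp_carrier by simp

lemma poly_ideal_Int:
  assumes "Y \<subseteq> X"
  shows "ideal (I \<inter> carrier (poly_ring Y)) (poly_ring Y)"
  using poly_ring_carrier_mono[OF assms]
  by (intro ideal_poly_ringI) (auto simp: poly_ideal_0 poly_ideal_add poly_ideal_mult)

text \<open>This is the colon ideal of \<open>I\<close> by \<open>g\<close>. It serves to adjoin one
  factor of a product lying in \<open>I\<close>, with the other factor as \<open>g\<close>.\<close>

lemma poly_ideal_colon:
  assumes "g \<in> carrier (poly_ring X)"
  shows "ideal {p \<in> carrier (poly_ring X). g * p \<in> I} (poly_ring X)"
proof (rule ideal_poly_ringI)
  fix p q assume "p \<in> {p \<in> carrier (poly_ring X). g * p \<in> I}" and q: "q \<in> carrier (poly_ring X)"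
  then show "q * p \<in> {p \<in> carrier (poly_ring X). g * p \<in> I}"
    using poly_ideal_mult[of "g * p" q] by (simp add: ac_simps)
qed (auto simp: poly_ideal_0 poly_ideal_add distrib_left)

end

section \<open>Intersections of prime ideals\<close>

text \<open>If every member of \<open>Q\<close> had an element outside \<open>p\<close>, the product
  of these elements would lie in the intersection but, by primality, outside \<open>p\<close>. For
  empty \<open>Q\<close> the intersection is the carrier, and \<open>p\<close> is proper.\<close>

lemma primeideal_finite_Inter:
  assumes "primeideal p R" "finite Q" and Q: "\<And>q. q \<in> Q \<Longrightarrow> ideal q R"
    and "carrier R \<inter> \<Inter>Q \<subseteq> p"
  shows "\<exists>q\<in>Q. q \<subseteq> p"
proof (rule ccontr)
  interpret p: primeideal p R by fact
  assume no: "\<not> ?thesis"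
  from \<open>finite Q\<close> Q no have "\<exists>a\<in>carrier R \<inter> \<Inter>Q. a \<notin> p"
  proof (induction Q)
    case empty
    then show ?case using p.I_notcarr p.a_subset by auto
  next
    case (insert q Q)
    then obtain a where a: "a \<in> carrier R" "a \<in> \<Inter>Q" "a \<notin> p" by auto
    obtain b where b: "b \<in> q" "b \<notin> p" using insert.prems by auto
    interpret q: ideal q R using insert.prems by simp
    have "a \<otimes>\<^bsub>R\<^esub> b \<in> q'" if "q' \<in> insert q Q" for q'
    proof -
      interpret q': ideal q' R using insert.prems that by simp
      show ?thesis
        using that a b q.I_l_closed q'.I_r_closed q.a_Hcarr by (cases "q' = q") auto
    qed
    moreover have "a \<otimes>\<^bsub>R\<^esub> b \<notin> p" using p.I_prime a b q.a_Hcarr by blast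
    ultimately show ?case using a b q.a_Hcarr by blast
  qed
  then show False using assms(4) by blast
qed

text \<open>A prime containing a power of \<open>a\<close> contains \<open>a\<close>; the exponent
  \<open>0\<close> is excluded because a prime does not contain the unit.\<close>

lemma radical_ideal_Inter_primes:
  assumes "cring R" "ideal I R" and I: "I = carrier R \<inter> \<Inter>P" and P: "\<And>p. p \<in> P \<Longrightarrow> primeideal p R"
  shows "radical_ideal I R"
proof -
  interpret cring R by fact
  have "a \<in> p" if a: "a \<in> carrier R" and "p \<in> P" "a [^]\<^bsub>R\<^esub> (m::nat) \<in> p" for a p m
  proof -
    interpret p: primeideal p R using P that by blast
    show ?thesis using that(3)
    proof (induction m)
      case 0
      then show ?case using p.I_notcarr p.one_imp_carrier by simp
    next
      case (Suc m)
      then show ?case using p.I_prime[of "a [^]\<^bsub>R\<^esub> m" a] a by auto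
    qed
  qed
  then have "radical R I \<subseteq> I" unfolding radical_def by (subst (2) I) (auto simp: I)
  moreover have "I \<subseteq> radical R I"
  proof
    fix a assume "a \<in> I"
    then have "a \<in> carrier R" "a [^]\<^bsub>R\<^esub> (1::nat) \<in> I" by (auto simp: I)
    then show "a \<in> radical R I" unfolding radical_def by blast
  qed
  ultimately show ?thesis using \<open>ideal I R\<close> by (auto simp: radical_ideal_def)
qed


section \<open>Points with binary coordinates\<close>

text \<open>The kernel of evaluation at the point \<open>z\<close>. Only the coordinates of
  \<open>z\<close> in \<open>X\<close> matter.\<close>

definition vanishing_ideal :: "'v set \<Rightarrow> ('v \<Rightarrow> F3) \<Rightarrow> 'v F3_poly set" where
  "vanishing_ideal X z = {p \<in> carrier (poly_ring X). poly_eval z p = 0}"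

lemma vanishing_ideal_prime: "primeideal (vanishing_ideal X z) (poly_ring X)"
proof (rule primeidealI)
  show "ideal (vanishing_ideal X z) (poly_ring X)"
    by (intro ideal_poly_ringI) (auto simp: vanishing_ideal_def)
  have "1 \<in> carrier (poly_ring X) - vanishing_ideal X z"
    by (simp add: vanishing_ideal_def)
  then show "carrier (poly_ring X) \<noteq> vanishing_ideal X z" by blast
qed (use F3_no_zero_divisors in \<open>auto simp: vanishing_ideal_def cring_poly_ring\<close>)

lemma vanishing_ideal_ideal: "ideal (vanishing_ideal X z) (poly_ring X)"
  by (rule primeideal.axioms(1)[OF vanishing_ideal_prime])

text \<open>Modulo \<open>J\<close> every variable is congruent to its coordinate, so every
  polynomial is congruent to its value at \<open>z\<close>.\<close>

lemma vanishing_ideal_subset: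
  assumes J: "ideal J (poly_ring X)" and gens: "\<And>v. v \<in> X \<Longrightarrow> Var v - Const (z v) \<in> J"
  shows "vanishing_ideal X z \<subseteq> J"
proof
  fix p assume p: "p \<in> vanishing_ideal X z"
  then have "p \<in> carrier (poly_ring X)" by (simp add: vanishing_ideal_def)
  then have "p - Const (poly_eval z p) \<in> J"
  proof (induction p rule: poly_ring_induct)
    case (Const c)
    then show ?case by (simp add: poly_ideal_0[OF J] flip: id_def)
  next
    case (Var v)
    then show ?case by (simp add: gens flip: id_def)
  next
    case (add p q)
    have "p + q - Const (poly_eval z (p + q)) =
        (p - Const (poly_eval z p)) + (q - Const (poly_eval z q))"
      by (simp add: Const_add)
    then show ?case using poly_ideal_add[OF J add.IH] by metis
  next
    case (mult p q)
    \<comment> \<open>With \<open>a\<close> and \<open>b\<close> the values of \<open>p\<close> and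
      \<open>q\<close>, this is \<open>p * q - a * b = q * (p - a) + a * (q - b)\<close>.\<close>
    have "p * q - Const (poly_eval z (p * q)) =
        q * (p - Const (poly_eval z p)) + Const (poly_eval z p) * (q - Const (poly_eval z q))"
      by (simp add: Const_mult algebra_simps)
    moreover have "q * (p - Const (poly_eval z p)) \<in> J"
      using poly_ideal_mult[OF J] mult by blast
    moreover have "Const (poly_eval z p) * (q - Const (poly_eval z q)) \<in> J"
      by (rule poly_ideal_mult[OF J mult.IH(2) poly_ring_Const])
    ultimately show ?case using poly_ideal_add[OF J] by metis
  qed
  then show "p \<in> J" using p by (simp add: vanishing_ideal_def)
qed

text \<open>An element of \<open>J\<close> with nonzero value \<open>c\<close> at \<open>z\<close>
  is congruent to \<open>Const c\<close> modulo the vanishing ideal, so \<open>J\<close> contains a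
  unit.\<close>

lemma vanishing_ideal_maximal:
  assumes J: "ideal J (poly_ring X)" and "J \<noteq> carrier (poly_ring X)"
    and sub: "vanishing_ideal X z \<subseteq> J"
  shows "J = vanishing_ideal X z"
proof (rule ccontr)
  assume "J \<noteq> vanishing_ideal X z"
  then obtain p where p: "p \<in> J" "p \<notin> vanishing_ideal X z" using sub by blast
  define c where "c = poly_eval z p"
  have carr: "p \<in> carrier (poly_ring X)" using p by (simp add: poly_ideal_carrier[OF J])
  then have "c \<noteq> 0" using p by (simp add: vanishing_ideal_def c_def)
  have "p - Const c \<in> J"
    using sub carr by (auto simp: vanishing_ideal_def c_def)
  then have "Const c \<in> J" using poly_ideal_diff[OF J p(1)] by fastforce
  then have "Const c * Const c \<in> J" by (intro poly_ideal_mult[OF J]) simp_all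
  then have "1 \<in> J" using \<open>c \<noteq> 0\<close> by (simp add: F3_square flip: Const_mult)
  then show False using assms(2) poly_ideal_eq_carrier[OF J] by blast
qed

text \<open>By maximality one inclusion suffices, and it holds because the linear generators at
  \<open>z\<close> vanish at \<open>z'\<close>.\<close>

lemma vanishing_ideal_cong:
  assumes "\<And>v. v \<in> X \<Longrightarrow> z v = z' v"
  shows "vanishing_ideal X z = vanishing_ideal X z'"
proof (rule sym, rule vanishing_ideal_maximal)
  show "vanishing_ideal X z \<subseteq> vanishing_ideal X z'"
    using assms
    by (intro vanishing_ideal_subset vanishing_ideal_ideal) (simp add: vanishing_ideal_def)
  show "vanishing_ideal X z' \<noteq> carrier (poly_ring X)"
    using primeideal.I_notcarr[OF vanishing_ideal_prime] by metis
qed (rule vanishing_ideal_ideal)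

text \<open>The ideals of the binary points in the variety of \<open>J\<close>. Points that agree on
  \<open>X\<close> give the same ideal and are counted once.\<close>

definition binary_primes :: "'v set \<Rightarrow> 'v F3_poly set \<Rightarrow> 'v F3_poly set set" where
  "binary_primes X J =
     {vanishing_ideal X z |z. z ` X \<subseteq> F2 \<and> J \<subseteq> vanishing_ideal X z}"

context
  fixes X :: "'v set" and J :: "'v F3_poly set"
  assumes finite_vars: "finite X" and J: "ideal J (poly_ring X)"
    and binary: "\<And>v. v \<in> X \<Longrightarrow> Var v ^ 2 - Var v \<in> J"
begin

text \<open>Adjoining \<open>Var v\<close> or \<open>Var v - 1\<close> one variable at a time, by passing to the
  colon ideal by the other factor of \<open>Var v ^ 2 - Var v\<close>, leads to the ideal of a point. One of
  the two colon ideals avoids \<open>f\<close>, since \<open>f\<close> is a difference of its multiples by the factors.\<close>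

lemma binary_point_avoiding:
  assumes f: "f \<in> carrier (poly_ring X)" "f \<notin> J"
  obtains z where "z ` X \<subseteq> F2" "J \<subseteq> vanishing_ideal X z" "f \<notin> vanishing_ideal X z"
proof -
  have "\<exists>K. ideal K (poly_ring X) \<and> J \<subseteq> K \<and> f \<notin> K \<and> (\<forall>v\<in>Y. Var v \<in> K \<or> Var v - 1 \<in> K)"
    if "finite Y" "Y \<subseteq> X" for Y
    using that
  proof (induction Y)
    case empty
    then show ?case using J f by blast
  next
    case (insert v Y)
    then obtain K where K: "ideal K (poly_ring X)" "J \<subseteq> K" "f \<notin> K"
      "\<forall>v\<in>Y. Var v \<in> K \<or> Var v - 1 \<in> K" by auto
    have v: "v \<in> X" using insert.prems by simp
    have vv: "Var v * (Var v - 1) \<in> K" "(Var v - 1) * Var v \<in> K"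
      using binary[OF v] K(2) by (auto simp: power2_eq_square algebra_simps)
    have "\<exists>g\<in>carrier (poly_ring X). g * f \<notin> K \<and> (g * Var v \<in> K \<or> g * (Var v - 1) \<in> K)"
    proof (cases "Var v * f \<in> K")
      case True
      have "f = Var v * f - (Var v - 1) * f" by (simp add: algebra_simps)
      then have "(Var v - 1) * f \<notin> K" using poly_ideal_diff[OF K(1) True] K(3) by metis
      then show ?thesis using vv v by (intro bexI[of _ "Var v - 1"]) simp_all
    next
      case False
      then show ?thesis using vv v by (intro bexI[of _ "Var v"]) simp_all
    qed
    then obtain g where g: "g \<in> carrier (poly_ring X)" "g * f \<notin> K"
      "g * Var v \<in> K \<or> g * (Var v - 1) \<in> K" by blast
    define K' where "K' = {p \<in> carrier (poly_ring X). g * p \<in> K}"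
    have "K \<subseteq> K'"
      using poly_ideal_mult[OF K(1) _ g(1)] poly_ideal_carrier[OF K(1)] by (auto simp: K'_def)
    moreover have "ideal K' (poly_ring X)"
      unfolding K'_def by (rule poly_ideal_colon[OF K(1) g(1)])
    moreover have "J \<subseteq> K'" and "\<forall>u\<in>Y. Var u \<in> K' \<or> Var u - 1 \<in> K'"
      using K(2,4) \<open>K \<subseteq> K'\<close> by blast+
    moreover have "f \<notin> K'" and "Var v \<in> K' \<or> Var v - 1 \<in> K'"
      using g v by (auto simp: K'_def)
    ultimately show ?case by (intro exI[of _ K']) blast
  qed
  from this[OF finite_vars subset_refl] obtain K
    where K: "ideal K (poly_ring X)" "J \<subseteq> K" "f \<notin> K" "\<forall>v\<in>X. Var v \<in> K \<or> Var v - 1 \<in> K"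
    by blast
  \<comment> \<open>The coordinates of the point are dictated by which linear factor lies in
    \<open>K\<close>. As \<open>f\<close> is not in \<open>K\<close>, the ideal \<open>K\<close> is
    proper, and maximality identifies it with the ideal of \<open>z\<close>.\<close>
  define z :: "'v \<Rightarrow> F3" where "z v = (if Var v \<in> K then 0 else 1)" for v
  have "vanishing_ideal X z \<subseteq> K"
    using K by (intro vanishing_ideal_subset) (auto simp: z_def)
  then have "K = vanishing_ideal X z"
    using K(1,3) f(1) by (intro vanishing_ideal_maximal) auto
  then show ?thesis using K by (intro that[of z]) (auto simp: z_def F2_def)
qed

text \<open>Primality splits \<open>Var v * (Var v - 1)\<close>, so \<open>p\<close> contains a
  linear generator for each variable; it then contains a maximal ideal and equals it.\<close>

lemma prime_over_binary_ideal:
  assumes "primeideal p (poly_ring X)" and "J \<subseteq> p"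
  obtains z where "z ` X \<subseteq> F2" "p = vanishing_ideal X z"
proof -
  interpret p: primeideal p "poly_ring X" by fact
  have p: "ideal p (poly_ring X)" by (rule p.is_ideal)
  have cases: "Var v \<in> p \<or> Var v - 1 \<in> p" if "v \<in> X" for v
    using p.I_prime[of "Var v" "Var v - 1"] binary[OF that] assms(2) that
    by (auto simp: power2_eq_square algebra_simps)
  define z :: "'v \<Rightarrow> F3" where "z v = (if Var v \<in> p then 0 else 1)" for v
  have "vanishing_ideal X z \<subseteq> p"
    using p cases by (intro vanishing_ideal_subset) (auto simp: z_def)
  then have "p = vanishing_ideal X z"
    using p p.I_notcarr by (intro vanishing_ideal_maximal) auto
  then show ?thesis by (intro that[of z]) (auto simp: z_def F2_def)
qed

text \<open>A binary point is determined on \<open>X\<close> by the set of variables at which it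
  takes the value \<open>1\<close>, and \<open>X\<close> has finitely many subsets.\<close>

lemma finite_binary_primes: "finite (binary_primes X J)"
proof (rule finite_subset)
  show "binary_primes X J \<subseteq> (\<lambda>A. vanishing_ideal X (\<lambda>v. of_bool (v \<in> A))) ` Pow X"
  proof
    fix p assume "p \<in> binary_primes X J"
    then obtain z where z: "p = vanishing_ideal X z" "z ` X \<subseteq> F2"
      by (auto simp: binary_primes_def)
    have "p = vanishing_ideal X (\<lambda>v. of_bool (v \<in> {v \<in> X. z v = 1}))"
      unfolding z(1) using z(2) by (intro vanishing_ideal_cong) (auto simp: F2_def)
    then show "p \<in> (\<lambda>A. vanishing_ideal X (\<lambda>v. of_bool (v \<in> A))) ` Pow X" by blast
  qed
qed (simp add: finite_vars)

lemma binary_primes_prime: "p \<in> binary_primes X J \<Longrightarrow> primeideal p (poly_ring X)"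
  by (auto simp: binary_primes_def vanishing_ideal_prime)

text \<open>A Nullstellensatz for binary points: any element outside \<open>J\<close> is nonzero at
  some binary point of the variety. For the unit ideal there are no such points and the right-hand
  side is the carrier.\<close>

lemma binary_ideal_eq_Inter: "J = carrier (poly_ring X) \<inter> \<Inter>(binary_primes X J)"
proof (rule antisym)
  show "J \<subseteq> carrier (poly_ring X) \<inter> \<Inter>(binary_primes X J)"
    using poly_ideal_carrier[OF J] by (auto simp: binary_primes_def)
  show "carrier (poly_ring X) \<inter> \<Inter>(binary_primes X J) \<subseteq> J"
  proof (rule subsetI, rule ccontr)
    fix f assume f: "f \<in> carrier (poly_ring X) \<inter> \<Inter>(binary_primes X J)" and "f \<notin> J"
    then obtain z where "z ` X \<subseteq> F2" "J \<subseteq> vanishing_ideal X z" "f \<notin> vanishing_ideal X z"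
      using binary_point_avoiding by blast
    then show False using f unfolding binary_primes_def by blast
  qed
qed

lemma binary_primes_antichain:
  assumes "p \<in> binary_primes X J" "q \<in> binary_primes X J" "q \<subseteq> p"
  shows "q = p"
proof -
  obtain z where "q = vanishing_ideal X z" using assms by (auto simp: binary_primes_def)
  then show ?thesis
    using vanishing_ideal_maximal[of p X z] binary_primes_prime[OF assms(1)] assms(3)
    by (metis primeideal.I_notcarr primeideal.axioms(1))
qed

text \<open>Existence and uniqueness at once: the primes over \<open>J\<close> are exactly the
  ideals of its binary points, and no two of them are comparable.\<close>

lemma prime_decomposition_binary_iff:
  "prime_decomposition (poly_ring X) J P \<longleftrightarrow> P = binary_primes X J"
proof
  assume P: "P = binary_primes X J"
  show "prime_decomposition (poly_ring X) J P"
    unfolding prime_decomposition_def P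
  proof (intro conjI ballI notI)
    fix p assume p: "p \<in> binary_primes X J"
      and eq: "carrier (poly_ring X) \<inter> \<Inter>(binary_primes X J - {p}) = J"
    \<comment> \<open>If \<open>p\<close> could be dropped, the intersection of the others would lie
      in \<open>p\<close>, so one of them would, against incomparability.\<close>
    have "\<exists>q\<in>binary_primes X J - {p}. q \<subseteq> p"
    proof (rule primeideal_finite_Inter[OF binary_primes_prime[OF p]])
      show "carrier (poly_ring X) \<inter> \<Inter>(binary_primes X J - {p}) \<subseteq> p"
        unfolding eq using p by (auto simp: binary_primes_def)
    qed (use finite_binary_primes binary_primes_prime primeideal.axioms(1) in blast)+
    then show False using binary_primes_antichain p by blast
  qed (rule finite_binary_primes binary_ideal_eq_Inter binary_primes_prime | assumption)+
next
  assume "prime_decomposition (poly_ring X) J P"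
  then have P: "finite P" "\<And>p. p \<in> P \<Longrightarrow> primeideal p (poly_ring X)"
    and J_eq: "J = carrier (poly_ring X) \<inter> \<Inter>P"
    by (auto simp: prime_decomposition_def)
  have sub: "P \<subseteq> binary_primes X J"
  proof
    fix p assume p: "p \<in> P"
    then have "J \<subseteq> p" using J_eq by blast
    then show "p \<in> binary_primes X J"
      using prime_over_binary_ideal[OF P(2)[OF p]] by (auto simp: binary_primes_def)
  qed
  have "p \<in> P" if p: "p \<in> binary_primes X J" for p
  proof -
    have "J \<subseteq> p" using p by (auto simp: binary_primes_def)
    \<comment> \<open>The intersection of \<open>P\<close> is \<open>J\<close> and lies in the prime
      \<open>p\<close>, so some member of \<open>P\<close> does; by incomparability that member is
      \<open>p\<close> itself.\<close>
    then have "\<exists>q\<in>P. q \<subseteq> p"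
      using P J_eq binary_primes_prime[OF p]
      by (intro primeideal_finite_Inter) (auto intro: primeideal.axioms(1))
    then show ?thesis using binary_primes_antichain[OF p] sub by blast
  qed
  then show "P = binary_primes X J" using sub by blast
qed

lemma binary_ideal_radical: "radical_ideal J (poly_ring X)"
  by (rule radical_ideal_Inter_primes[OF cring_poly_ring J binary_ideal_eq_Inter binary_primes_prime])

end


section \<open>Puzzle ideals\<close>

lemma cell_sides_in_puzzle_vars: "c \<in> big_triangle n \<Longrightarrow> set (cell_sides c) \<subseteq> puzzle_vars n"
  by (auto simp: intervals_def)

lemma bottom_vars_subset: "bottom_vars n \<subseteq> puzzle_vars n"
proof
  fix v assume "v \<in> bottom_vars n"
  then obtain j where "j < n" "v = (Bot, int j, 0)" by (auto simp: bottom_vars_def bottom_side_def)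
  then show "v \<in> puzzle_vars n"
    using cell_sides_in_puzzle_vars[of "Up (int j) 0" n] by (simp add: big_triangle_def)
qed

lemma left_side_in_puzzle_vars: "j < n \<Longrightarrow> left_side n j \<in> puzzle_vars n"
  using cell_sides_in_puzzle_vars[of "Up 0 (int j)" n] by (simp add: left_side_def big_triangle_def)

lemma right_side_in_puzzle_vars: "j < n \<Longrightarrow> right_side n j \<in> puzzle_vars n"
  \<comment> \<open>The coordinates of this cell sum to \<open>n - 1\<close>, the largest value
    allowed for upward cells.\<close>
  using cell_sides_in_puzzle_vars[of "Up (int j) (int n - 1 - int j)" n]
  by (simp add: right_side_def big_triangle_def)

lemma bottom_side_in_bottom_vars: "j < n \<Longrightarrow> bottom_side n j \<in> bottom_vars n"
  by (simp add: bottom_vars_def)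

lemma length_cell_sides: "length (cell_sides c) = 3"
  by (cases c) simp_all

lemma length_rhombus_sides: "length (rhombus_sides m) = 4"
  by (cases m rule: rhombus_sides.cases) simp_all

lemma rhombus_sides_in_intervals: "set (rhombus_sides m) \<subseteq> intervals (rhombus m)"
  by (cases m rule: rhombus_sides.cases) (auto simp: intervals_def)

lemma intervals_mono: "S \<subseteq> T \<Longrightarrow> intervals S \<subseteq> intervals T"
  by (auto simp: intervals_def)

lemma cell_sides_shift: "cell_sides (shift_cell e c) = map (shift_interval e) (cell_sides c)"
  by (cases e; cases c) simp_all

lemma intervals_shift: "intervals (shift_cell e ` S) = shift_interval e ` intervals S"
  by (auto simp: intervals_def cell_sides_shift)

lemma nth_image_subset: "length xs = k \<Longrightarrow> set xs \<subseteq> A \<Longrightarrow> (\<lambda>l. xs ! l) ` {..<k} \<subseteq> A"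
  by (auto simp: subset_iff)

section \<open>Membership of the generators in the polynomial rings\<close>

lemma free_gens_1_carrier: "free_gens_1 n \<subseteq> carrier (poly_ring (puzzle_vars n))"
  using bottom_vars_subset[of n] by (auto simp: free_gens_1_def)

lemma gens_1_carrier: "gens_1 n \<subseteq> carrier (poly_ring (puzzle_vars n))"
  by (auto simp: gens_1_def)

lemma free_gens_2_carrier: "free_gens_2 n lam mu \<subseteq> carrier (poly_ring (puzzle_vars n))"
  by (auto simp: free_gens_2_def left_side_in_puzzle_vars right_side_in_puzzle_vars)

lemma bottom_gens_carrier: "bottom_gens n nu \<subseteq> carrier (poly_ring (bottom_vars n))"
  by (auto simp: bottom_gens_def bottom_side_in_bottom_vars)

lemma gens_3_carrier: "gens_3 n \<subseteq> carrier (poly_ring (puzzle_vars n))"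
  using cell_sides_in_puzzle_vars by (force simp: gens_3_def intro!: poly_ring_sum_list)

lemma gens_4_carrier:
  assumes "valid_choice Om tb C"
  shows "gens_4 n C \<subseteq> carrier (poly_ring (puzzle_vars n))"
proof -
  have "poly_subst (\<lambda>l. cell_sides c ! l) f \<in> carrier (poly_ring (puzzle_vars n))"
    if "f \<in> carrier (poly_ring {..<3})" "c \<in> big_triangle n" for c f
    by (rule poly_subst_in_poly_ring[OF that(1)],
        rule nth_image_subset[OF length_cell_sides cell_sides_in_puzzle_vars[OF that(2)]])
  then show ?thesis
    using assms unfolding gens_4_def valid_choice_def distinguishing_def by blast
qed

lemma gens_5_carrier:
  assumes "valid_choice Om tb C"
  shows "gens_5 n C \<subseteq> carrier (poly_ring (puzzle_vars n))"
proof -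
  have "poly_subst (\<lambda>l. rhombus_sides m ! l) f \<in> carrier (poly_ring (puzzle_vars n))"
    if "f \<in> carrier (poly_ring {..<4})" "rhombus m \<subseteq> big_triangle n" for m f
    by (rule poly_subst_in_poly_ring[OF that(1)], rule nth_image_subset[OF length_rhombus_sides])
      (use rhombus_sides_in_intervals[of m] intervals_mono[OF that(2)] in blast)
  then show ?thesis
    using assms unfolding gens_5_def valid_choice_def forbidding_def by blast
qed

text \<open>The variables of an implying polynomial are intervals of the shape of \<open>p\<close>.
  Translation carries them to intervals of the translated shape, which lies in the big
  triangle.\<close>

lemma gens_6_carrier:
  assumes "valid_choice Om tb C"
  shows "gens_6 n Om tb C \<subseteq> carrier (poly_ring (puzzle_vars n))"
proof
  fix g assume "g \<in> gens_6 n Om tb C"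
  then obtain p a e where g: "g = poly_subst (shift_interval e) (impl_poly C a)"
    and a: "p \<in> big_pieces Om" "a \<in> implicit_wrt Om tb p" "implying_kind a"
    and sub: "shift_cell e ` fst p \<subseteq> big_triangle n"
    by (auto simp: gens_6_def)
  obtain q where "q \<in> stitching (tb p)" "a = piece_of q"
    using a(2) by (auto simp: implicit_wrt_def pieces_in_def)
  then have "implying tb p q (impl_poly C a)"
    using assms a by (simp add: valid_choice_def)
  then have "impl_poly C a \<in> carrier (poly_ring (intervals (fst p)))"
    by (simp add: implying_def)
  then show "g \<in> carrier (poly_ring (puzzle_vars n))"
    unfolding g
    by (rule poly_subst_in_poly_ring) (use intervals_mono[OF sub] in \<open>simp add: intervals_shift\<close>)
qed

section \<open>Ideals of points on the bottom side\<close>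

text \<open>The generators vanish at the point, and conversely they make every polynomial congruent
  to its value there. The point reads \<open>nu\<close> at the first coordinate, since
  \<open>bottom_side n j\<close> is \<open>(Bot, int j, 0)\<close>.\<close>

lemma point_ideal_eq:
  "point_ideal n nu = vanishing_ideal (bottom_vars n) (\<lambda>(d, a, b). nu ! nat a)"
proof -
  interpret R: cring "poly_ring (bottom_vars n)" by (rule cring_poly_ring)
  show ?thesis unfolding point_ideal_def
  proof (rule antisym)
    show "Idl\<^bsub>poly_ring (bottom_vars n)\<^esub> (bottom_gens n nu) \<subseteq>
        vanishing_ideal (bottom_vars n) (\<lambda>(d, a, b). nu ! nat a)"
      using bottom_gens_carrier
      by (intro R.genideal_minimal vanishing_ideal_ideal)
        (auto simp: vanishing_ideal_def bottom_gens_def bottom_side_def bottom_vars_def)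
    show "vanishing_ideal (bottom_vars n) (\<lambda>(d, a, b). nu ! nat a) \<subseteq>
        Idl\<^bsub>poly_ring (bottom_vars n)\<^esub> (bottom_gens n nu)"
      using R.genideal_self[OF bottom_gens_carrier[of n nu]]
      by (intro vanishing_ideal_subset R.genideal_ideal bottom_gens_carrier)
        (auto simp: bottom_vars_def bottom_gens_def bottom_side_def)
  qed
qed

lemma vanishing_ideal_eq_point_ideal:
  assumes "z ` bottom_vars n \<subseteq> F2"
  obtains nu where "binary_seq n nu" "vanishing_ideal (bottom_vars n) z = point_ideal n nu"
proof
  let ?nu = "map (\<lambda>j. z (bottom_side n j)) [0..<n]"
  show "binary_seq n ?nu"
    using assms by (auto simp: binary_seq_def bottom_vars_def)
  show "vanishing_ideal (bottom_vars n) z = point_ideal n ?nu"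
    unfolding point_ideal_eq
    by (rule vanishing_ideal_cong) (auto simp: bottom_vars_def bottom_side_def)
qed

section \<open>The free puzzle ideal, its elimination ideal and the puzzle ideals\<close>

context
  fixes n :: nat and lam mu :: "F3 list" and Om :: "placed_piece set"
    and tb :: "placed_piece \<Rightarrow> placed_piece set" and C :: poly_choice
  assumes valid: "valid_choice Om tb C"
begin

interpretation R: cring "poly_ring (puzzle_vars n)" by (rule cring_poly_ring)

lemma free_puzzle_ideal_gens_carrier:
  "free_gens_1 n \<union> free_gens_2 n lam mu \<union> gens_3 n \<union> gens_4 n C \<union> gens_5 n C \<union> gens_6 n Om tb C
    \<subseteq> carrier (poly_ring (puzzle_vars n))"
  using free_gens_1_carrier free_gens_2_carrier gens_3_carrier gens_4_carrier[OF valid]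
    gens_5_carrier[OF valid] gens_6_carrier[OF valid] by (intro Un_least)

lemma puzzle_ideal_gens_carrier:
  "gens_1 n \<union> gens_2 n lam mu nu \<union> gens_3 n \<union> gens_4 n C \<union> gens_5 n C \<union> gens_6 n Om tb C
    \<subseteq> carrier (poly_ring (puzzle_vars n))"
  unfolding gens_2_def
  using gens_1_carrier free_gens_2_carrier gens_3_carrier gens_4_carrier[OF valid]
    gens_5_carrier[OF valid] gens_6_carrier[OF valid]
    subset_trans[OF bottom_gens_carrier poly_ring_carrier_mono[OF bottom_vars_subset]]
  by (intro Un_least)

lemma free_puzzle_ideal_ideal: "ideal (free_puzzle_ideal n lam mu Om tb C) (poly_ring (puzzle_vars n))"
  unfolding free_puzzle_ideal_def by (rule R.genideal_ideal[OF free_puzzle_ideal_gens_carrier])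

lemma puzzle_ideal_ideal: "ideal (puzzle_ideal n lam mu nu Om tb C) (poly_ring (puzzle_vars n))"
  unfolding puzzle_ideal_def by (rule R.genideal_ideal[OF puzzle_ideal_gens_carrier])

lemmas free_puzzle_ideal_gens =
  R.genideal_self[OF free_puzzle_ideal_gens_carrier, folded free_puzzle_ideal_def]

lemmas puzzle_ideal_gens =
  R.genideal_self[OF puzzle_ideal_gens_carrier, folded puzzle_ideal_def]

lemma elimination_ideal_ideal:
  "ideal (elimination_ideal n lam mu Om tb C) (poly_ring (bottom_vars n))"
  unfolding elimination_ideal_def
  by (rule poly_ideal_Int[OF free_puzzle_ideal_ideal bottom_vars_subset])

text \<open>The quadratic generators involve bottom variables only, so they survive
  elimination.\<close>

lemma elimination_ideal_binary:
  assumes "v \<in> bottom_vars n"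
  shows "Var v ^ 2 - Var v \<in> elimination_ideal n lam mu Om tb C"
proof -
  have "Var v ^ 2 - Var v \<in> free_gens_1 n" using assms unfolding free_gens_1_def by blast
  then show ?thesis
    using free_puzzle_ideal_gens assms by (auto simp: elimination_ideal_def)
qed

text \<open>At a point of the variety the quadratic equations force each coordinate to be a root of
  \<open>x ^ 2 - x\<close>.\<close>

lemma bottom_variety_binary:
  assumes "nu \<in> bottom_variety n (elimination_ideal n lam mu Om tb C)"
  shows "binary_seq n nu"
proof -
  have "nu ! j \<in> F2" if "j < n" for j
  proof -
    have "poly_eval (\<lambda>(d, a, b). nu ! nat a) (Var (bottom_side n j) ^ 2 - Var (bottom_side n j)) = 0"
      using assms elimination_ideal_binary[OF bottom_side_in_bottom_vars[OF that]]
      unfolding bottom_variety_def by blast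
    then show ?thesis by (simp add: bottom_side_def F2_iff)
  qed
  then show ?thesis
    using assms by (auto simp: bottom_variety_def binary_seq_def in_set_conv_nth)
qed

text \<open>The two generating sets differ only in the field equations of the bottom variables and
  in \<open>bottom_gens\<close>, so only these have to be derived from the other side.\<close>

lemma puzzle_ideal_eq_sum:
  assumes nu: "binary_seq n nu"
  shows "puzzle_ideal n lam mu nu Om tb C =
    Idl\<^bsub>poly_ring (puzzle_vars n)\<^esub> (free_puzzle_ideal n lam mu Om tb C \<union> point_ideal n nu)"
    (is "?I = Idl\<^bsub>_\<^esub> (?F \<union> ?p)")
proof (rule antisym)
  interpret B: cring "poly_ring (bottom_vars n)" by (rule cring_poly_ring)
  have p_carrier: "?p \<subseteq> carrier (poly_ring (puzzle_vars n))"
    using poly_ring_carrier_mono[OF bottom_vars_subset]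
    by (auto simp: point_ideal_eq vanishing_ideal_def)
  have F_carrier: "?F \<subseteq> carrier (poly_ring (puzzle_vars n))"
    using poly_ideal_carrier[OF free_puzzle_ideal_ideal] by blast
  define S where "S = Idl\<^bsub>poly_ring (puzzle_vars n)\<^esub> (?F \<union> ?p)"
  have S: "ideal S (poly_ring (puzzle_vars n))" and FS: "?F \<subseteq> S" and pS: "?p \<subseteq> S"
    unfolding S_def using F_carrier p_carrier R.genideal_ideal R.genideal_self[of "?F \<union> ?p"] by auto
  have I: "ideal ?I (poly_ring (puzzle_vars n))" by (rule puzzle_ideal_ideal)
  have "Var v ^ 3 - Var v \<in> S" if v: "v \<in> puzzle_vars n" for v
  proof (cases "v \<in> bottom_vars n")
    case True
    then have "Var v ^ 2 - Var v \<in> free_gens_1 n" unfolding free_gens_1_def by blast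
    then have "Var v ^ 2 - Var v \<in> S" using free_puzzle_ideal_gens FS by blast
    \<comment> \<open>The product is \<open>Var v ^ 3 - Var v\<close>.\<close>
    then have "(Var v + 1) * (Var v ^ 2 - Var v) \<in> S"
      using v by (intro poly_ideal_mult[OF S]) simp_all
    then show ?thesis by (simp add: algebra_simps power2_eq_square power3_eq_cube)
  next
    case False
    then have "Var v ^ 3 - Var v \<in> free_gens_1 n" using v unfolding free_gens_1_def by blast
    then show ?thesis using free_puzzle_ideal_gens FS by blast
  qed
  then have "gens_1 n \<subseteq> S" by (auto simp: gens_1_def)
  moreover have "bottom_gens n nu \<subseteq> S"
    using B.genideal_self[OF bottom_gens_carrier] pS unfolding point_ideal_def by blast
  ultimately show "?I \<subseteq> Idl\<^bsub>poly_ring (puzzle_vars n)\<^esub> (?F \<union> ?p)"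
    unfolding puzzle_ideal_def S_def[symmetric]
    using free_puzzle_ideal_gens FS by (intro R.genideal_minimal S) (auto simp: gens_2_def)
  have bottom: "bottom_gens n nu \<subseteq> ?I"
    using puzzle_ideal_gens by (auto simp: gens_2_def)
  have "Var v ^ 2 - Var v \<in> ?I" if v: "v \<in> bottom_vars n" for v
  proof -
    obtain j where j: "j < n" "v = bottom_side n j" using v by (auto simp: bottom_vars_def)
    have g: "Var v - Const (nu ! j) \<in> ?I" using bottom j by (auto simp: bottom_gens_def)
    have "nu ! j \<in> F2" using nu j by (auto simp: binary_seq_def)
    then have "Const (nu ! j) * Const (nu ! j) = (Const (nu ! j) :: interval F3_poly)"
      by (auto simp: F2_def)
    \<comment> \<open>With \<open>c = nu ! j\<close>, the product expands to
      \<open>Var v ^ 2 - Var v - c * c + c\<close>, and \<open>c * c = c\<close> as \<open>c\<close>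
      is binary.\<close>
    then have "Var v ^ 2 - Var v = (Var v + Const (nu ! j) - 1) * (Var v - Const (nu ! j))"
      by (simp add: algebra_simps power2_eq_square)
    then show ?thesis
      using subsetD[OF bottom_vars_subset v] by (simp add: poly_ideal_mult[OF I g])
  qed
  moreover have "gens_1 n \<subseteq> ?I" using puzzle_ideal_gens by blast
  ultimately have "free_gens_1 n \<subseteq> ?I"
    unfolding free_gens_1_def gens_1_def by blast
  then have "?F \<subseteq> ?I"
    unfolding free_puzzle_ideal_def
    using puzzle_ideal_gens by (intro R.genideal_minimal I) (auto simp: gens_2_def)
  \<comment> \<open>The ideal \<open>?p\<close> is generated in the smaller ring, so
    \<open>?I\<close> is first cut down to an ideal of that ring.\<close>
  moreover have "?p \<subseteq> ?I \<inter> carrier (poly_ring (bottom_vars n))"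
    unfolding point_ideal_def
    by (intro B.genideal_minimal poly_ideal_Int[OF I bottom_vars_subset] Int_greatest
        bottom bottom_gens_carrier)
  ultimately show "Idl\<^bsub>poly_ring (puzzle_vars n)\<^esub> (?F \<union> ?p) \<subseteq> ?I"
    by (intro R.genideal_minimal I) blast
qed

end

theorem proposition7p3:
  fixes n k :: nat
    and lam mu :: "F3 list"
    and Om :: "placed_piece set"
    and tb :: "placed_piece \<Rightarrow> placed_piece set"
    and C :: poly_choice
  assumes "0 < k" and "k \<le> n"
    and "binary_seq n lam" and "count_list lam 1 = k"
    and "binary_seq n mu" and "count_list mu 1 = k"
    and "puzzle_pieces Om"
    and "refining_tilings Om tb"
    and "separable Om tb"
    and "valid_choice Om tb C"
  shows
    "radical_ideal (elimination_ideal n lam mu Om tb C) (poly_ring (bottom_vars n)) \<and>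
     ((\<exists>!P. prime_decomposition (poly_ring (bottom_vars n))
               (elimination_ideal n lam mu Om tb C) P) \<and>
      (\<forall>P. prime_decomposition (poly_ring (bottom_vars n))
               (elimination_ideal n lam mu Om tb C) P \<longrightarrow>
         (\<forall>p\<in>P. \<exists>nu. binary_seq n nu \<and> p = point_ideal n nu))) \<and>
     (\<forall>nu \<in> bottom_variety n (elimination_ideal n lam mu Om tb C).
        binary_seq n nu \<and>
        puzzle_ideal n lam mu nu Om tb C =
          Idl\<^bsub>poly_ring (puzzle_vars n)\<^esub>
            (free_puzzle_ideal n lam mu Om tb C \<union> point_ideal n nu))"
  proof -
  let ?B = "bottom_vars n" and ?E = "elimination_ideal n lam mu Om tb C"
  note valid = \<open>valid_choice Om tb C\<close>
  have fin: "finite ?B" by (simp add: bottom_vars_def)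
  \<comment> \<open>The results on binary points apply to the elimination ideal, with the bottom
    variables as the finite set of variables.\<close>
  note E = fin elimination_ideal_ideal[OF valid] elimination_ideal_binary[OF valid]
  have radical: "radical_ideal ?E (poly_ring ?B)"
    by (rule binary_ideal_radical[OF E])
  have decomposition: "prime_decomposition (poly_ring ?B) ?E P \<longleftrightarrow> P = binary_primes ?B ?E" for P
    by (rule prime_decomposition_binary_iff[OF E])
  have "\<exists>nu. binary_seq n nu \<and> p = point_ideal n nu" if p: "p \<in> binary_primes ?B ?E" for p
  proof -
    obtain z where "z ` ?B \<subseteq> F2" "p = vanishing_ideal ?B z"
      using p unfolding binary_primes_def by blast
    then show ?thesis using vanishing_ideal_eq_point_ideal by metis
  qed
  then show ?thesis
    using radical decomposition bottom_variety_binary[OF valid] puzzle_ideal_eq_sum[OF valid]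
    by auto
qed

end
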